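(* Let $G=(V,E)$ be a chordal graph. Then the set $\{\xi^W : W\subseteq V\text{ is an induced path of } G\}$ of extended incidence vectors of induced paths of $G$ forms a Hilbert basis of the cone $\mathcal{C}_P(G)$; that is, all these vectors belong to $\mathcal{C}_P(G)$, and every integer point of $\mathcal{C}_P(G)$ is a nonnegative integer combination of them.
   Context: All graphs are finite and simple. A graph is chordal if it has no induced cycle of length at least 4. A clique is a set of pairwise adjacent vertices (the empty set is allowed). $N(w)$ is the set of neighbors of $w$. An induced path of $G$ is a (nonempty) vertex set $W\subseteq V$ whose elements can be ordered as $v_1,\dots,v_p$ so that the edges of $G[W]$ are exactly $v_iv_{i+1}$, $1\le i\le p-1$ (a single vertex is an induced path). $E(W)$ is the set of edges of $G$ with both endpoints in $W$. The extended incidence vector of $W\subseteq V$ is $\xi^W=(\chi^W,\zeta^{E(W)})\in\{0,1\}^V\times\{0,1\}^E$, where $\chi^W$ and $\zeta^{E(W)}$ are the 0/1 indicator vectors of $W$ and $E(W)$. For $U\subseteq V$, $C(U)$ is the set of vertices not in $U$ adjacent to every vertex of $U$. For $w\in V$ and $U\subseteq V$, $\delta(w,U)$ is the set of edges joining $w$ to a vertex of $U$, and $y(F)=\sum_{e\in F}y_e$ for $F\subseteq E$. $\mathcal{C}_P(G)$ is the cone of all $(x,y)\in\mathbb{R}^V\times\mathbb{R}^E$ satisfying $$y\bigl(\delta(w,C(K\cup\{w\}))\bigr)+2\,y\bigl(\delta(w,K)\bigr)\le 2x_w\quad\forall w\in V,\ \text{cliques }K\subseteq N(w);$$ $$x_w\ge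 0\quad\forall w\in V;\qquad y_e\ge 0\quad\forall e\in E.$$ *)

theory Defs
  imports Complex_Main "HOL-Library.Indicator_Function"
begin

text \<open>
  A graph is given by its vertex set \<open>V\<close> and its edge set \<open>E\<close>; an edge is the two-element set
  of its endpoints.
\<close>

definition simple_graph :: "'a set \<Rightarrow> 'a set set \<Rightarrow> bool" where
  "simple_graph V E \<longleftrightarrow> finite V \<and> E \<subseteq> {e. e \<subseteq> V \<and> card e = 2}"

definition induced_edges :: "'a set set \<Rightarrow> 'a set \<Rightarrow> 'a set set" where
  "induced_edges E W = {e \<in> E. e \<subseteq> W}"

definition neighbors :: "'a set set \<Rightarrow> 'a \<Rightarrow> 'a set" where
  "neighbors E w = {v. {w, v} \<in> E}"

definition clique :: "'a set \<Rightarrow> 'a set set \<Rightarrow> 'a set \<Rightarrow> bool" where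
  "clique V E K \<longleftrightarrow> K \<subseteq> V \<and> (\<forall>u\<in>K. \<forall>v\<in>K. u \<noteq> v \<longrightarrow> {u, v} \<in> E)"

definition induced_path :: "'a set \<Rightarrow> 'a set set \<Rightarrow> 'a set \<Rightarrow> bool" where
  "induced_path V E W \<longleftrightarrow> W \<subseteq> V \<and>
     (\<exists>vs. vs \<noteq> [] \<and> distinct vs \<and> set vs = W \<and>
        induced_edges E W = {{vs ! i, vs ! Suc i} |i. Suc i < length vs})"

text \<open>
  The vertices of an induced cycle, listed in cyclic order; the length of the cycle is the length
  of the list.
\<close>

definition induced_cycle :: "'a set \<Rightarrow> 'a set set \<Rightarrow> 'a list \<Rightarrow> bool" where
  "induced_cycle V E vs \<longleftrightarrow> set vs \<subseteq> V \<and> distinct vs \<and> length vs \<ge> 3 \<and>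
     induced_edges E (set vs) = {{vs ! i, vs ! (Suc i mod length vs)} |i. i < length vs}"

definition chordal :: "'a set \<Rightarrow> 'a set set \<Rightarrow> bool" where
  "chordal V E \<longleftrightarrow> \<not> (\<exists>vs. induced_cycle V E vs \<and> length vs \<ge> 4)"

definition common_neighbors :: "'a set \<Rightarrow> 'a set set \<Rightarrow> 'a set \<Rightarrow> 'a set" where
  "common_neighbors V E U = {v \<in> V. v \<notin> U \<and> (\<forall>u\<in>U. {u, v} \<in> E)}"

definition edges_to :: "'a set set \<Rightarrow> 'a \<Rightarrow> 'a set \<Rightarrow> 'a set set" where
  "edges_to E w U = {{w, u} |u. u \<in> U \<and> {w, u} \<in> E}"

text \<open>
  The space of pairs \<open>(x, y)\<close> with \<open>x\<close> indexed by \<open>V\<close> and \<open>y\<close> indexed by \<open>E\<close> is rendered as the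
  set of pairs of total functions that vanish outside \<open>V\<close> and \<open>E\<close>, respectively.
\<close>

type_synonym 'a point = "('a \<Rightarrow> real) \<times> ('a set \<Rightarrow> real)"

definition point_space :: "'a set \<Rightarrow> 'a set set \<Rightarrow> 'a point set" where
  "point_space V E = {(x, y). (\<forall>v. v \<notin> V \<longrightarrow> x v = 0) \<and> (\<forall>e. e \<notin> E \<longrightarrow> y e = 0)}"

definition integer_point :: "'a point \<Rightarrow> bool" where
  "integer_point z \<longleftrightarrow> (\<forall>v. fst z v \<in> \<int>) \<and> (\<forall>e. snd z e \<in> \<int>)"

definition ext_incidence :: "'a set set \<Rightarrow> 'a set \<Rightarrow> 'a point" where
  "ext_incidence E W = (indicator W, indicator (induced_edges E W))"

definition path_cone :: "'a set \<Rightarrow> 'a set set \<Rightarrow> 'a point set" where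
  "path_cone V E = {(x, y) \<in> point_space V E.
     (\<forall>w\<in>V. \<forall>K. clique V E K \<and> K \<subseteq> neighbors E w \<longrightarrow>
        sum y (edges_to E w (common_neighbors V E (K \<union> {w}))) + 2 * sum y (edges_to E w K)
          \<le> 2 * x w) \<and>
     (\<forall>w\<in>V. x w \<ge> 0) \<and>
     (\<forall>e\<in>E. y e \<ge> 0)}"

definition hilbert_basis :: "'a point set \<Rightarrow> 'a point set \<Rightarrow> bool" where
  "hilbert_basis H C \<longleftrightarrow> H \<subseteq> C \<and>
     (\<forall>z\<in>C. integer_point z \<longrightarrow>
        (\<exists>S (c :: 'a point \<Rightarrow> nat). finite S \<and> S \<subseteq> H \<and>
           z = ((\<lambda>v. \<Sum>h\<in>S. real (c h) * fst h v), (\<lambda>e. \<Sum>h\<in>S. real (c h) * snd h e))))"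

end

theory Submission
  imports Defs "HOL-Library.Multiset"
begin

text \<open>
  An integer point \<open>(x, y)\<close> of the cone is viewed as a multigraph with \<open>y\<^sub>e\<close> copies of each edge
  \<open>e\<close>. At every vertex \<open>w\<close>, the copies of edges at \<open>w\<close> are matched so that matched copies lead to
  distinct nonadjacent neighbors. The neighborhood of \<open>w\<close> is chordal, so the graph of allowed pairs
  is \<open>2K\<^sub>2\<close>-free, and the Tutte--Berge formula for its maximum matchings reduces to the clique
  inequalities: integrality of \<open>x\<^sub>w\<close> absorbs the parity term, and the number of unmatched copies and
  matched pairs is at most \<open>x\<^sub>w\<close>. Following the matchings glues the edge copies into walks all of whose
  consecutive triples are induced paths; in a chordal graph such a walk is itself an induced path.
  The remaining slack of \<open>x\<^sub>w\<close> is filled with one-vertex paths.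
\<close>

section \<open>Maximum matchings of \<open>2K\<^sub>2\<close>-free graphs\<close>

text \<open>A matching is encoded as an involution, whose fixed points are the uncovered vertices.\<close>

definition is_matching :: "'b set \<Rightarrow> ('b \<Rightarrow> 'b \<Rightarrow> bool) \<Rightarrow> ('b \<Rightarrow> 'b) \<Rightarrow> bool" where
  "is_matching T G m \<longleftrightarrow> (\<forall>t\<in>T. m t \<in> T \<and> m (m t) = t \<and> (m t \<noteq> t \<longrightarrow> G t (m t)))"

definition fixed :: "'b set \<Rightarrow> ('b \<Rightarrow> 'b) \<Rightarrow> 'b set" where
  "fixed T m = {t \<in> T. m t = t}"

definition max_matching :: "'b set \<Rightarrow> ('b \<Rightarrow> 'b \<Rightarrow> bool) \<Rightarrow> ('b \<Rightarrow> 'b) \<Rightarrow> bool" where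
  "max_matching T G m \<longleftrightarrow> is_matching T G m \<and>
     (\<forall>n. is_matching T G n \<longrightarrow> card (fixed T m) \<le> card (fixed T n))"

lemma finite_fixed [simp]: "finite T \<Longrightarrow> finite (fixed T m)"
  by (simp add: fixed_def)

lemma ex_max_matching: "\<exists>m. max_matching T G m"
proof -
  have "is_matching T G (\<lambda>t. t)"
    by (simp add: is_matching_def)
  then show ?thesis
    using exists_least_iff[of "\<lambda>k. \<exists>m. is_matching T G m \<and> card (fixed T m) = k"]
    unfolding max_matching_def by (metis not_le)
qed

text \<open>Orbits of an involution have size one or two, and the sum counts each fixed point twice.
  The induction removes one orbit \<open>{t, m t}\<close>.\<close>

lemma even_card_add_fixed:
  assumes "finite T" "\<And>t. t \<in> T \<Longrightarrow> m t \<in> T" "\<And>t. t \<in> T \<Longrightarrow> m (m t) = t"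
  shows "even (card T + card (fixed T m))"
  using assms
proof (induction "card T" arbitrary: T rule: less_induct)
  case less
  show ?case
  proof (cases "T = {}")
    case True
    then show ?thesis by (simp add: fixed_def)
  next
    case False
    then obtain t where t: "t \<in> T" by blast
    let ?S = "T - {t, m t}"
    have S: "m s \<in> ?S" if "s \<in> ?S" for s
      using that less.prems t by (metis Diff_iff insert_iff singletonD)
    have "card ?S < card T"
      using t less.prems(1) by (intro psubset_card_mono) auto
    then have even: "even (card ?S + card (fixed ?S m))"
      using less.hyps[of ?S] less.prems S by auto
    have T: "T = insert t (insert (m t) ?S)"
      using t less.prems(2) by auto
    show ?thesis
    proof (cases "m t = t")
      case True
      have "fixed T m = insert t (fixed ?S m)"
        using T True t by (auto simp: fixed_def)
      then have "card (fixed T m) = Suc (card (fixed ?S m))"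
        using less.prems(1) by (simp add: fixed_def)
      moreover have "card T = Suc (card ?S)"
        using True t less.prems(1) by (metis card_Suc_Diff1 insert_absorb2)
      ultimately show ?thesis using even by simp
    next
      case False
      have "fixed T m = fixed ?S m"
        using False t less.prems(3) by (auto simp: fixed_def)
      moreover have "card T = Suc (Suc (card ?S))"
        using False T less.prems(1)
        by (metis Diff_iff card_insert_disjoint finite_insert insert_iff)
      ultimately show ?thesis using even by simp
    qed
  qed
qed

lemma matching_even:
  "finite T \<Longrightarrow> is_matching T G m \<Longrightarrow> even (card T + card (fixed T m))"
  by (rule even_card_add_fixed) (auto simp: is_matching_def)

text \<open>Gallai's lemma: among the maximum matchings \<open>n\<close> missing \<open>t\<close>, the one that agrees most with
  \<open>m\<close> can be rotated towards \<open>m\<close>.\<close>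

lemma gallai_transitive:
  assumes fin: "finite T" and sym: "\<And>a b. G a b \<Longrightarrow> G b a"
    and t: "t \<in> T" "max_matching T G n0" "n0 t = t"
    and uv: "u \<in> T" "v \<in> T" "u \<noteq> v" and m: "max_matching T G m" "m u = u" "m v = v"
  shows "\<exists>n. max_matching T G n \<and> n t = t \<and> (t \<noteq> u \<and> n u = u \<or> t \<noteq> v \<and> n v = v)"
proof (rule ccontr)
  assume contra: "\<not> ?thesis"
  let ?A = "\<lambda>n. {s \<in> T. n s = m s}"
  obtain n where n: "max_matching T G n" "n t = t"
    and best: "\<And>n'. max_matching T G n' \<Longrightarrow> n' t = t \<Longrightarrow> card (?A n') \<le> card (?A n)"
  proof -
    have "?A n' \<subseteq> T" for n' by blast
    then have "card (?A n') < Suc (card T)" for n'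
      using fin by (simp add: less_Suc_eq_le card_mono)
    then show ?thesis
      using ex_has_greatest_nat[of "\<lambda>n. max_matching T G n \<and> n t = t" n0 "\<lambda>n. card (?A n)"] t that
      by blast
  qed
  \<comment> \<open>If \<open>t\<close> were \<open>u\<close> or \<open>v\<close>, then
    \<open>m\<close> itself would be a witness.\<close>
  have tuv: "t \<noteq> u" "t \<noteq> v"
    using contra m uv by metis+
  have mt: "m t \<noteq> t"
    using contra m tuv by metis
  have nuv: "n u \<noteq> u" "n v \<noteq> v"
    using contra n tuv by metis+
  have M: "is_matching T G m" and N: "is_matching T G n"
    using m n by (auto simp: max_matching_def)
  have eq: "card (fixed T m) = card (fixed T n)"
    using m(1) n(1) unfolding max_matching_def by (meson le_antisym)
  \<comment> \<open>Both matchings miss equally many vertices, but one is dropped on the left and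
    two on the right. Hence \<open>n\<close> misses some \<open>x \<noteq> t\<close> that
    \<open>m\<close> covers.\<close>
  have "\<not> fixed T n - {t} \<subseteq> fixed T m - {u, v}"
  proof
    assume "fixed T n - {t} \<subseteq> fixed T m - {u, v}"
    then have "card (fixed T n - {t}) \<le> card (fixed T m - {u, v})"
      using fin by (intro card_mono) auto
    moreover have "card (fixed T n - {t}) = card (fixed T n) - 1"
      using n t by (simp add: fixed_def)
    moreover have "card (fixed T m - {u, v}) = card (fixed T m) - 2"
      using m uv fin by (subst card_Diff_subset) (auto simp: fixed_def)
    moreover have "card {u, v} \<le> card (fixed T m)"
      using m uv fin by (intro card_mono) (auto simp: fixed_def)
    ultimately show False using eq uv by simp
  qed
  then obtain x where x: "x \<in> T" "n x = x" "x \<noteq> t" "m x \<noteq> x"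
    using nuv by (auto simp: fixed_def)
  define y where "y = m x"
  have y: "y \<in> T" "m y = x" "G x y" "y \<noteq> x"
    using M x by (auto simp: is_matching_def y_def)
  have ny: "n y \<noteq> y"
  proof
    assume ny: "n y = y"
    let ?n = "n(x := y, y := x)"
    have "is_matching T G ?n"
      using N x y ny sym unfolding is_matching_def by (smt (verit) fun_upd_apply)
    moreover have "fixed T ?n \<subset> fixed T n"
      using x y ny by (auto simp: fixed_def)
    ultimately show False
      using n(1) fin unfolding max_matching_def by (meson finite_fixed leD psubset_card_mono)
  qed
  define z where "z = n y"
  have z: "z \<in> T" "n z = y" "z \<noteq> x" "z \<noteq> y" "z \<noteq> t"
    using N x y ny n(2) by (auto simp: is_matching_def z_def)
  \<comment> \<open>The rotation replaces the edge \<open>yz\<close> of \<open>n\<close> by the edge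
    \<open>xy\<close> of \<open>m\<close>. The number of missed vertices stays the same,
    \<open>t\<close> remains missed, and agreement with \<open>m\<close> is gained at
    \<open>x\<close> and lost nowhere, since \<open>m\<close> pairs \<open>y\<close> with
    \<open>x\<close> and not with \<open>z\<close>.\<close>
  let ?n = "n(x := y, y := x, z := z)"
  have "is_matching T G ?n"
    using N x y ny z sym unfolding is_matching_def by (smt (verit) fun_upd_apply)
  moreover have "fixed T ?n = insert z (fixed T n - {x})"
    using x y z ny by (auto simp: fixed_def)
  then have "card (fixed T ?n) = card (fixed T n)"
    using x y z fin card_Suc_Diff1[of "fixed T n" x] by (simp add: fixed_def)
  ultimately have "max_matching T G ?n"
    using n(1) by (simp add: max_matching_def)
  moreover have "?n t = t"
    using x y z n ny by auto
  moreover have "?A n \<subset> ?A ?n"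
  proof -
    have "m z \<noteq> y"
      using M x y z by (metis is_matching_def)
    then have "?A n \<subseteq> ?A ?n"
      using x y z by (auto simp: y_def)
    moreover have "x \<in> ?A ?n" "x \<notin> ?A n"
      using x y z by (auto simp: y_def)
    ultimately show ?thesis by blast
  qed
  then have "card (?A n) < card (?A ?n)"
    using fin by (intro psubset_card_mono) auto
  ultimately show False
    using best by fastforce
qed

text \<open>A Tutte--Berge formula: since a \<open>2K\<^sub>2\<close>-free graph has at most one nontrivial component, the
  only obstructions are an independent set \<open>K\<close> together with the vertices not adjacent to it.\<close>

lemma matching_obstruction:
  assumes "finite T" and sym: "\<And>a b. G a b \<Longrightarrow> G b a" and irr: "\<And>a. \<not> G a a"
    and free: "\<And>a b c d. a \<in> T \<Longrightarrow> b \<in> T \<Longrightarrow> c \<in> T \<Longrightarrow> d \<in> T \<Longrightarrow> G a b \<Longrightarrow> G c d \<Longrightarrow>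
      a = c \<or> a = d \<or> b = c \<or> b = d \<or> G a c \<or> G a d \<or> G b c \<or> G b d"
  shows "\<exists>m K. is_matching T G m \<and> K \<subseteq> T \<and> (\<forall>a\<in>K. \<forall>b\<in>K. \<not> G a b) \<and>
    card T + card (fixed T m) \<le> 2 * card K + card {c \<in> T - K. \<forall>a\<in>K. \<not> G a c} + 1"
  using assms(1) free
proof (induction "card T" arbitrary: T rule: less_induct)
  case less
  note fin = less.prems(1)
  obtain m where m: "max_matching T G m"
    using ex_max_matching by blast
  then have M: "is_matching T G m" by (simp add: max_matching_def)
  show ?case
  proof (cases "\<exists>v\<in>T. \<forall>n. max_matching T G n \<longrightarrow> n v \<noteq> v")
    case True
    then obtain v where v: "v \<in> T" and covered: "\<And>n. max_matching T G n \<Longrightarrow> n v \<noteq> v"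
      by blast
    let ?T = "T - {v}"
    have "card ?T < card T"
      using v fin by (intro psubset_card_mono) auto
    then obtain n K where n: "is_matching ?T G n" and K: "K \<subseteq> ?T" "\<forall>a\<in>K. \<forall>b\<in>K. \<not> G a b"
      and le: "card ?T + card (fixed ?T n) \<le> 2 * card K + card {c \<in> ?T - K. \<forall>a\<in>K. \<not> G a c} + 1"
      using less.hyps[of ?T] fin less.prems(2) by (auto; blast)
    let ?n = "n(v := v)"
    have nT: "is_matching T G ?n"
      using n by (auto simp: is_matching_def)
    have "fixed T ?n = insert v (fixed ?T n)"
      using v by (auto simp: fixed_def)
    then have cn: "card (fixed T ?n) = Suc (card (fixed ?T n))"
      using fin by (simp add: fixed_def)
    \<comment> \<open>As \<open>?n\<close> misses \<open>v\<close>, it is not maximum, and by parity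
      it misses at least two vertices more than \<open>m\<close>. One of the two accounts for
      \<open>v\<close>, the other for the difference between \<open>card T\<close> and
      \<open>card ?T\<close>.\<close>
    have "\<not> max_matching T G ?n"
      using covered by fastforce
    then have "card (fixed T m) < card (fixed T ?n)"
      using m nT unfolding max_matching_def by (meson le_trans not_less)
    moreover have "even (card T + card (fixed T m))" "even (card T + card (fixed T ?n))"
      using matching_even[OF fin] M nT by blast+
    ultimately have "Suc (card (fixed T m)) < card (fixed T ?n)"
      by (metis Suc_lessI even_Suc even_add)
    moreover have "card T = Suc (card ?T)"
      using v fin by (simp add: card_Suc_Diff1 del: card_Diff_insert card_Diff_singleton)
    moreover have "card {c \<in> ?T - K. \<forall>a\<in>K. \<not> G a c} \<le> card {c \<in> T - K. \<forall>a\<in>K. \<not> G a c}"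
      using fin by (intro card_mono) auto
    ultimately have "card T + card (fixed T m)
        \<le> 2 * card K + card {c \<in> T - K. \<forall>a\<in>K. \<not> G a c} + 1"
      using le cn by linarith
    moreover have "K \<subseteq> T"
      using K by blast
    ultimately show ?thesis
      using M K(2) by blast
  next
    case False
    then have missed: "\<And>v. v \<in> T \<Longrightarrow> \<exists>n. max_matching T G n \<and> n v = v" by blast
    \<comment> \<open>The independent set consists of the isolated vertices. Distinct vertices are
      related by \<open>R\<close> if no maximum matching misses both; Gallai's lemma makes
      \<open>R\<close> transitive, because here every vertex is missed by some maximum
      matching.\<close>
    define K where "K = {v \<in> T. \<forall>u\<in>T. \<not> G v u}"
    define R where "R u v \<longleftrightarrow> (\<forall>n. max_matching T G n \<longrightarrow> n u = u \<longrightarrow> n v = v \<longrightarrow> u = v)" for u v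
    have Rsym: "R u v \<Longrightarrow> R v u" for u v
      by (auto simp: R_def)
    have Rtrans: "R u v" if "u \<in> T" "t \<in> T" "v \<in> T" "R u t" "R t v" for u t v
      using gallai_transitive[of T G t _ u v] missed[of t] fin sym that unfolding R_def by metis
    have RG: "R u v" if uv: "u \<in> T" "v \<in> T" "G u v" for u v
      unfolding R_def
    proof (intro allI impI)
      fix n assume n: "max_matching T G n" "n u = u" "n v = v"
      show "u = v"
      proof (rule ccontr)
        assume "u \<noteq> v"
        let ?n = "n(u := v, v := u)"
        have "is_matching T G ?n"
          using n uv sym unfolding is_matching_def max_matching_def by (smt (verit) fun_upd_apply)
        moreover have "fixed T ?n \<subset> fixed T n"
          using uv n \<open>u \<noteq> v\<close> by (auto simp: fixed_def)
        ultimately show False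
          using n(1) fin unfolding max_matching_def by (meson finite_fixed leD psubset_card_mono)
      qed
    qed
    \<comment> \<open>Choose an edge at \<open>u\<close> and one at \<open>v\<close>. They share a
      vertex or are joined by an edge, and edges lie in \<open>R\<close>, so \<open>T - K\<close> is
      a single class, in which \<open>m\<close> misses at most one vertex.\<close>
    have R: "R u v" if "u \<in> T - K" "v \<in> T - K" for u v
    proof -
      have "\<exists>a\<in>T. G u a" "\<exists>b\<in>T. G v b"
        using that by (auto simp: K_def)
      then obtain a b where ab: "a \<in> T" "G u a" "b \<in> T" "G v b"
        by blast
      have "R u a" "R b v"
        using RG[of u a] RG[of v b] Rsym ab that by auto
      moreover have "R x x" for x by (simp add: R_def)
      ultimately show ?thesis
        using less.prems(2)[of u a v b] ab that RG Rtrans Rsym by (metis DiffD1)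
    qed
    have "\<forall>u\<in>fixed T m - K. \<forall>v\<in>fixed T m - K. u = v"
      using R m unfolding R_def fixed_def by blast
    then have "card (fixed T m - K) \<le> 1"
      using fin by (simp add: card_le_Suc0_iff_eq)
    moreover have "card (fixed T m) - card K \<le> card (fixed T m - K)"
      by (rule diff_card_le_card_Diff) (simp add: K_def fin)
    moreover have "{c \<in> T - K. \<forall>a\<in>K. \<not> G a c} = T - K"
      by (auto simp: K_def)
    then have "card {c \<in> T - K. \<forall>a\<in>K. \<not> G a c} = card (T - K)"
      by simp
    moreover have "card T = card K + card (T - K)"
      using card_Int_Diff[OF fin, of K] by (simp add: Int_absorb1 K_def subset_iff)
    ultimately have "card T + card (fixed T m)
        \<le> 2 * card K + card {c \<in> T - K. \<forall>a\<in>K. \<not> G a c} + 1"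
      by linarith
    moreover have "K \<subseteq> T" "\<forall>a\<in>K. \<forall>b\<in>K. \<not> G a b"
      by (auto simp: K_def)
    ultimately show ?thesis
      using M by blast
  qed
qed

section \<open>Walks in chordal graphs\<close>

text \<open>A shortest violation would close up to an induced cycle.\<close>

lemma chordal_walk_aux:
  assumes graph: "simple_graph V E" "chordal V E"
    and edge: "\<And>i. i < L \<Longrightarrow> {v i, v (Suc i)} \<in> E"
    and turn: "\<And>i. Suc i < L \<Longrightarrow> v i \<noteq> v (Suc (Suc i)) \<and> {v i, v (Suc (Suc i))} \<notin> E"
    and ij: "i < j" "j \<le> L"
  shows "v i \<noteq> v j \<and> ({v i, v j} \<in> E \<longrightarrow> j = Suc i)"
  using ij
proof (induction "j - i" arbitrary: i j rule: less_induct)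
  case less
  have IH: "v a \<noteq> v b \<and> ({v a, v b} \<in> E \<longrightarrow> b = Suc a)" if "b - a < j - i" "a < b" "b \<le> L" for a b
    using less.hyps that by blast
  consider "j = Suc i" | "j = Suc (Suc i)" | "Suc (Suc i) < j"
    using less.prems by linarith
  then show ?case
  proof cases
    case 1
    then have "{v i, v j} \<in> E" using edge less.prems by auto
    then have "card {v i, v j} = 2" using graph by (auto simp: simple_graph_def)
    then show ?thesis using 1 by auto
  next
    case 2
    then show ?thesis using turn[of i] less.prems by auto
  next
    case 3
    \<comment> \<open>If \<open>v i = v j\<close>, the last step of the walk makes
      \<open>v (j - 1)\<close> adjacent to \<open>v i\<close>. At this smaller distance adjacency is
      possible only for successive positions.\<close>
    have ne: "v i \<noteq> v j"
    proof
      assume "v i = v j"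
      moreover have "{v (j - 1), v j} \<in> E"
        using edge[of "j - 1"] less.prems by auto
      ultimately have "{v i, v (j - 1)} \<in> E"
        by (simp add: insert_commute)
      moreover have "v i \<noteq> v (j - 1) \<and> ({v i, v (j - 1)} \<in> E \<longrightarrow> j - 1 = Suc i)"
        by (rule IH) (use 3 less.prems in linarith)+
      ultimately have "j - 1 = Suc i"
        by simp
      then show False
        using 3 by linarith
    qed
    have "{v i, v j} \<notin> E"
    proof
      assume ij: "{v i, v j} \<in> E"
      \<comment> \<open>The chord closes this stretch of the walk to a cycle. All pairs of positions
        other than \<open>i\<close> and \<open>j\<close> are closer together, so the induction
        hypothesis shows that the cycle is induced; \<open>Suc (Suc i) < j\<close> gives it at least
        four vertices.\<close>
      let ?vs = "map v [i..<Suc j]"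
      have len: "length ?vs = Suc j - i" by (simp del: upt_Suc)
      have nth: "?vs ! k = v (i + k)" if "k < Suc j - i" for k
        using that by (simp del: upt_Suc)
      have dist: "v a \<noteq> v b" if "i \<le> a" "a < b" "b \<le> j" for a b
      proof (cases "a = i \<and> b = j")
        case False
        then have "b - a < j - i" using that by linarith
        then show ?thesis using IH that less.prems by auto
      qed (use ne in simp)
      have "inj_on v {i..<Suc j}"
        using dist by (intro linorder_inj_onI) auto
      then have "distinct ?vs"
        by (simp add: distinct_map del: upt_Suc)
      moreover have "set ?vs \<subseteq> V"
      proof -
        have "v k \<in> V" if "k \<le> j" "i \<le> k" for k
        proof (cases "k < j")
          case True
          then have "{v k, v (Suc k)} \<in> E" using edge less.prems by auto
          then show ?thesis using graph by (auto simp: simple_graph_def)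
        next
          case False
          then show ?thesis using ij that graph by (auto simp: simple_graph_def)
        qed
        then show ?thesis by auto
      qed
      moreover have "induced_edges E (set ?vs) =
          {{?vs ! k, ?vs ! (Suc k mod length ?vs)} |k. k < length ?vs}"
      proof (intro equalityI subsetI)
        fix e assume "e \<in> induced_edges E (set ?vs)"
        then have e: "e \<in> E" "e \<subseteq> v ` {i..j}"
          by (auto simp: induced_edges_def atLeastLessThanSuc_atLeastAtMost simp del: upt_Suc)
        then obtain x y where "e = {x, y}" "x \<noteq> y"
          using graph by (auto simp: simple_graph_def card_2_iff)
        moreover from this obtain a' b' where "x = v a'" "y = v b'" "a' \<in> {i..j}" "b' \<in> {i..j}"
          using e by auto
        ultimately obtain a b where ab: "e = {v a, v b}" "i \<le> a" "a < b" "b \<le> j"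
          by (metis atLeastAtMost_iff insert_commute linorder_neqE_nat)
        show "e \<in> {{?vs ! k, ?vs ! (Suc k mod length ?vs)} |k. k < length ?vs}"
        proof (cases "a = i \<and> b = j")
          case True
          then have "e = {?vs ! (j - i), ?vs ! (Suc (j - i) mod length ?vs)}"
            using ab less.prems by (simp add: len nth Suc_diff_le insert_commute del: upt_Suc)
          then show ?thesis using less.prems len by auto
        next
          case False
          then have "b = Suc a"
            using IH[of b a] ab e less.prems by auto
          then have "e = {?vs ! (a - i), ?vs ! (Suc (a - i) mod length ?vs)}"
            using ab less.prems by (simp add: len nth del: upt_Suc)
          then show ?thesis using ab less.prems len by auto
        qed
      next
        fix e assume "e \<in> {{?vs ! k, ?vs ! (Suc k mod length ?vs)} |k. k < length ?vs}"
        then obtain k where k: "k < Suc j - i" "e = {?vs ! k, ?vs ! (Suc k mod length ?vs)}"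
          using len by auto
        have "e \<in> E"
        proof (cases "Suc k = Suc j - i")
          case True
          then have "i + k = j"
            using less.prems by linarith
          with True have "e = {v j, v i}"
            using k by (simp add: len nth del: upt_Suc)
          then show ?thesis using ij by (simp add: insert_commute)
        next
          case False
          then show ?thesis using k edge[of "i + k"] less.prems by (simp add: len nth del: upt_Suc)
        qed
        moreover have "e \<subseteq> set ?vs"
          using k len by (metis empty_subsetI insert_subset less_nat_zero_code mod_less_divisor
              nth_mem zero_less_iff_neq_zero)
        ultimately show "e \<in> induced_edges E (set ?vs)"
          by (simp add: induced_edges_def)
      qed
      ultimately have "induced_cycle V E ?vs"
        using len 3 by (simp add: induced_cycle_def del: upt_Suc)
      then show False
        using graph len 3 by (auto simp: chordal_def)
    qed
    then show ?thesis using ne by simp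
  qed
qed

text \<open>By \<open>chordal_walk_aux\<close>, different positions carry different vertices, and
  only successive ones are adjacent. The premise \<open>v 0 \<in> V\<close> takes care of
  \<open>L = 0\<close>, where no edge places the vertex in \<open>V\<close>.\<close>

lemma chordal_walk:
  assumes graph: "simple_graph V E" "chordal V E"
    and edge: "\<And>i. i < L \<Longrightarrow> {v i, v (Suc i)} \<in> E"
    and turn: "\<And>i. Suc i < L \<Longrightarrow> v i \<noteq> v (Suc (Suc i)) \<and> {v i, v (Suc (Suc i))} \<notin> E"
  shows "inj_on v {..L}"
    and "induced_edges E (v ` {..L}) = (\<lambda>i. {v i, v (Suc i)}) ` {..<L}"
    and "v 0 \<in> V \<Longrightarrow> induced_path V E (v ` {..L})"
proof -
  note aux = chordal_walk_aux[of V E L v, OF graph edge turn]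
  show inj: "inj_on v {..L}"
    using aux by (intro linorder_inj_onI) auto
  show edges: "induced_edges E (v ` {..L}) = (\<lambda>i. {v i, v (Suc i)}) ` {..<L}"
  proof (intro equalityI subsetI)
    fix e assume "e \<in> induced_edges E (v ` {..L})"
    then have e: "e \<in> E" "e \<subseteq> v ` {..L}"
      by (auto simp: induced_edges_def)
    then obtain x y where "e = {x, y}" "x \<noteq> y"
      using graph by (auto simp: simple_graph_def card_2_iff)
    then obtain a' b' where "e = {v a', v b'}" "a' \<noteq> b'" "a' \<le> L" "b' \<le> L"
      using e by auto
    then obtain a b where ab: "e = {v a, v b}" "a < b" "b \<le> L"
      by (metis insert_commute linorder_neqE_nat)
    then have "b = Suc a"
      using aux[of a b] e by auto
    then show "e \<in> (\<lambda>i. {v i, v (Suc i)}) ` {..<L}"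
      using ab by auto
  qed (auto simp: induced_edges_def edge)
  assume "v 0 \<in> V"
  have "v ` {..L} \<subseteq> V"
  proof -
    have "v i \<in> V" if "i \<le> L" for i
    proof (cases i)
      case (Suc k)
      then have "{v k, v i} \<in> E" using edge that by auto
      then show ?thesis using graph by (auto simp: simple_graph_def)
    qed (use \<open>v 0 \<in> V\<close> in simp)
    then show ?thesis by auto
  qed
  moreover have "distinct (map v [0..<Suc L])" "set (map v [0..<Suc L]) = v ` {..L}"
    using inj by (auto simp: distinct_map atLeast0LessThan lessThan_Suc_atMost simp del: upt_Suc)
  moreover have "induced_edges E (v ` {..L}) =
      {{map v [0..<Suc L] ! i, map v [0..<Suc L] ! Suc i} |i. Suc i < length (map v [0..<Suc L])}"
    unfolding edges
    by (intro set_eqI, unfold image_iff Bex_def mem_Collect_eq, intro iff_exI) (auto simp del: upt_Suc)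
  ultimately show "induced_path V E (v ` {..L})"
    unfolding induced_path_def by (intro conjI exI[of _ "map v [0..<Suc L]"]) auto
qed

section \<open>Gluing the edges along local matchings\<close>

text \<open>Edges with multiplicities are given by their darts: \<open>src t\<close> is the origin of the dart \<open>t\<close>,
  \<open>r\<close> reverses darts, and \<open>m\<close> pairs a dart with the dart at the same origin by which a path
  through that origin continues; the fixed points of \<open>m\<close> are the ends of the paths.\<close>

lemma dart_walk:
  fixes src :: "'b \<Rightarrow> 'a"
  assumes graph: "simple_graph V E" "chordal V E"
    and r: "\<forall>t\<in>D. r t \<in> D \<and> r (r t) = t \<and> {src t, src (r t)} \<in> E"
    and m: "\<forall>t\<in>D. m t \<in> D \<and> m (m t) = t \<and> src (m t) = src t"
    and turn: "\<forall>t\<in>D. m t \<noteq> t \<longrightarrow>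
      src (r t) \<noteq> src (r (m t)) \<and> {src (r t), src (r (m t))} \<notin> E"
    and t: "t \<in> D"
    and d: "\<And>i. d i = ((\<lambda>t. m (r t)) ^^ i) t"
    and n: "\<forall>i<n. m (r (d i)) \<noteq> r (d i)"
  shows "d i \<in> D" "src (d (Suc i)) = src (r (d i))"
    and "inj_on (\<lambda>i. src (d i)) {..Suc n}"
    and "induced_edges E ((\<lambda>i. src (d i)) ` {..Suc n}) = (\<lambda>i. {src (d i), src (r (d i))}) ` {..n}"
    and "induced_path V E ((\<lambda>i. src (d i)) ` {..Suc n})"
proof -
  \<comment> \<open>One step crosses the current edge by \<open>r\<close> and then turns by
    \<open>m\<close> into the next dart.\<close>
  have dSuc: "d (Suc i) = m (r (d i))" for i by (simp add: d)
  show D: "d i \<in> D" for i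
    by (induction i) (use t r m in \<open>auto simp: dSuc d[of 0]\<close>)
  show src: "src (d (Suc i)) = src (r (d i))" for i
    using D r m by (simp add: dSuc)
  let ?v = "\<lambda>i. src (d i)"
  have edge: "{?v i, ?v (Suc i)} \<in> E" for i
    using D r src by simp
  have turn': "?v i \<noteq> ?v (Suc (Suc i)) \<and> {?v i, ?v (Suc (Suc i))} \<notin> E" if "Suc i < Suc n" for i
  proof -
    have "?v (Suc (Suc i)) = src (r (m (r (d i))))"
      using src[of "Suc i"] by (simp only: dSuc)
    then show ?thesis
      using turn n that D[of i] r by fastforce
  qed
  \<comment> \<open>There are \<open>n\<close> turns between \<open>Suc n\<close> edges; the final
    vertex \<open>src (d (Suc n))\<close> is the far end of \<open>d n\<close>.\<close>
  note walk = chordal_walk[of V E "Suc n" ?v, OF graph edge turn']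
  show "inj_on ?v {..Suc n}" by (rule walk)
  show "induced_edges E (?v ` {..Suc n}) = (\<lambda>i. {src (d i), src (r (d i))}) ` {..n}"
    using walk(2) by (simp add: src lessThan_Suc_atMost)
  have "?v 0 \<in> V" using edge[of 0] graph by (auto simp: simple_graph_def)
  then show "induced_path V E (?v ` {..Suc n})" using walk(3) by blast
qed

text \<open>Induction on the number of darts, removing one complete path in both directions. The
  factors 2 arise because an edge copy has two darts and an inner vertex of a path has two matched
  darts. An end has a single dart, fixed by \<open>m\<close>, which \<open>of_bool (m t = t)\<close>
  counts once more.\<close>

lemma dart_decomposition:
  fixes src :: "'b \<Rightarrow> 'a"
  assumes graph: "simple_graph V E" "chordal V E" and "finite D"
    and "\<forall>t\<in>D. r t \<in> D \<and> r (r t) = t \<and> {src t, src (r t)} \<in> E"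
    and "\<forall>t\<in>D. m t \<in> D \<and> m (m t) = t \<and> src (m t) = src t"
    and "\<forall>t\<in>D. m t \<noteq> t \<longrightarrow>
      src (r t) \<noteq> src (r (m t)) \<and> {src (r t), src (r (m t))} \<notin> E"
  shows "\<exists>M. (\<forall>W\<in>#M. induced_path V E W) \<and>
    (\<forall>w. 2 * (\<Sum>W\<in>#M. of_bool (w \<in> W)) = (\<Sum>t\<in>D. of_bool (src t = w) * (1 + of_bool (m t = t)) :: nat)) \<and>
    (\<forall>e. 2 * (\<Sum>W\<in>#M. of_bool (e \<in> induced_edges E W)) =
      (\<Sum>t\<in>D. of_bool ({src t, src (r t)} = e) :: nat))"
  using assms(3-)
proof (induction "card D" arbitrary: D rule: less_induct)
  case less
  note fin = less.prems(1) and r = less.prems(2) and m = less.prems(3) and turn = less.prems(4)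
  show ?case
  proof (cases "D = {}")
    case True
    then show ?thesis by (intro exI[of _ "{#}"]) auto
  next
    case False
    have finV: "finite V" using graph by (simp add: simple_graph_def)
    \<comment> \<open>A walk that never stops would make \<open>card V\<close> turns and thus visit
      more than \<open>card V\<close> distinct vertices.\<close>
    have ends: "\<exists>n. m (r (((\<lambda>t. m (r t)) ^^ n) t)) = r (((\<lambda>t. m (r t)) ^^ n) t)" if t: "t \<in> D" for t
    proof (rule ccontr)
      assume "\<not> ?thesis"
      then have inf: "\<forall>i<card V. m (r (((\<lambda>t. m (r t)) ^^ i) t)) \<noteq> r (((\<lambda>t. m (r t)) ^^ i) t)"
        by blast
      note walk = dart_walk[of V E D r src m t "\<lambda>i. ((\<lambda>t. m (r t)) ^^ i) t" "card V",
          OF graph r m turn t refl inf]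
      let ?v = "\<lambda>i. src (((\<lambda>t. m (r t)) ^^ i) t)"
      have "?v ` {..Suc (card V)} \<subseteq> V"
        using walk(5) by (simp add: induced_path_def)
      then have "card {..Suc (card V)} \<le> card V"
        using card_inj_on_le[OF walk(3) _ finV] by blast
      then show False by simp
    qed
    \<comment> \<open>The reversal of the last dart of a walk is fixed by \<open>m\<close>, so a
      path can start there.\<close>
    obtain t where t: "t \<in> D" "m t = t"
    proof -
      obtain s where s: "s \<in> D" using False by blast
      then obtain n where n: "m (r (((\<lambda>t. m (r t)) ^^ n) s)) = r (((\<lambda>t. m (r t)) ^^ n) s)"
        using ends by blast
      have "((\<lambda>t. m (r t)) ^^ n) s \<in> D"
        by (induction n) (simp_all add: s r m)
      then show ?thesis
        using that[OF _ n] r by simp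
    qed
    define d where "d i = ((\<lambda>t. m (r t)) ^^ i) t" for i
    define n where "n = (LEAST n. m (r (d n)) = r (d n))"
    have last: "m (r (d n)) = r (d n)"
      using ends[OF t(1)] LeastI_ex[of "\<lambda>n. m (r (d n)) = r (d n)"] unfolding n_def d_def by blast
    have inner: "\<forall>i<n. m (r (d i)) \<noteq> r (d i)"
      using not_less_Least unfolding n_def by blast
    note walk = dart_walk[of V E D r src m t d n, OF graph r m turn t(1) d_def inner]
    have d0: "d 0 = t" and dSuc: "d (Suc i) = m (r (d i))" for i by (simp_all add: d_def)
    define W where "W = (\<lambda>i. src (d i)) ` {..Suc n}"
    define P where "P = d ` {..n} \<union> (\<lambda>i. r (d i)) ` {..n}"
    have inj: "src (d i) = src (d j) \<longleftrightarrow> i = j" if "i \<le> Suc n" "j \<le> Suc n" for i j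
      using inj_onD[OF walk(3), of i j] that by auto
    have injd: "inj_on d {..n}"
      using inj by (intro inj_onI) (metis atMost_iff le_SucI)
    have injr: "inj_on (\<lambda>i. r (d i)) {..n}"
      using injd r walk(1) unfolding inj_on_def by metis
    \<comment> \<open>Running back along one of its own darts would force \<open>i = Suc j\<close>
      and \<open>j = Suc i\<close>.\<close>
    have disj: "d i \<noteq> r (d j)" if "i \<le> n" "j \<le> n" for i j
    proof
      assume eq: "d i = r (d j)"
      then have "src (d i) = src (d (Suc j))" using walk(2) by simp
      then have "i = Suc j" using inj that by auto
      moreover have "r (d i) = d j" using eq r walk(1) by metis
      then have "src (d (Suc i)) = src (d j)" using walk(2) by metis
      then have "Suc i = j" using inj that by auto
      ultimately show False by simp
    qed
    have PD: "P \<subseteq> D" using walk(1) r by (auto simp: P_def)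
    have sumP: "(\<Sum>t\<in>P. g t) = (\<Sum>i\<le>n. g (d i) + g (r (d i)))" for g :: "'b \<Rightarrow> nat"
      using disj unfolding P_def
      by (subst sum.union_disjoint) (auto simp: sum.reindex[OF injd] sum.reindex[OF injr] sum.distrib)
    have md: "m (d (Suc i)) = r (d i)" for i
      using m r walk(1) by (simp add: dSuc)
    \<comment> \<open>In \<open>P\<close> exactly the first dart and the reversal of the last one
      are fixed by \<open>m\<close>: the two ends of the path.\<close>
    have fix_d: "m (d i) = d i \<longleftrightarrow> i = 0" if "i \<le> n" for i
    proof (cases i)
      case 0
      then show ?thesis using t d0 by simp
    next
      case (Suc j)
      then show ?thesis using inner[rule_format, of j] md[of j] dSuc[of j] that by auto
    qed
    have fix_r: "m (r (d i)) = r (d i) \<longleftrightarrow> i = n" if "i \<le> n" for i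
      using inner[rule_format, of i] last that by (cases "i = n") auto
    \<comment> \<open>Closure of \<open>P\<close> under \<open>r\<close> and \<open>m\<close> lets
      the remaining darts inherit the hypotheses.\<close>
    have rP: "r s \<in> P" if "s \<in> P" for s
      using that r walk(1) by (auto simp: P_def)
    have mP: "m s \<in> P" if "s \<in> P" for s
    proof -
      have "(\<exists>i\<le>n. s = d i) \<or> (\<exists>i\<le>n. s = r (d i))"
        using that by (auto simp: P_def)
      then consider i where "i \<le> n" "s = d i" | i where "i \<le> n" "s = r (d i)"
        by blast
      then show ?thesis
      proof cases
        case (1 i)
        then show ?thesis using t d0 md by (cases i) (auto simp: P_def)
      next
        case (2 i)
        show ?thesis
        proof (cases "i = n")
          case True
          then show ?thesis using 2 that last by simp
        next
          case False
          then have "m s = d (Suc i)" "Suc i \<le> n" using 2 by (auto simp: dSuc)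
          then show ?thesis by (auto simp: P_def)
        qed
      qed
    qed
    have countW: "(\<Sum>s\<in>P. of_bool (src s = w) * (1 + of_bool (m s = s))) = 2 * (of_bool (w \<in> W) :: nat)" for w
    proof -
      let ?f = "\<lambda>i. of_bool (src (d i) = w) :: nat"
      have "(\<Sum>s\<in>P. of_bool (src s = w) * (1 + of_bool (m s = s))) =
          (\<Sum>i\<le>n. ?f i * (1 + of_bool (i = 0)) + ?f (Suc i) * (1 + of_bool (i = n)))"
        unfolding sumP by (intro sum.cong) (auto simp: fix_d fix_r walk(2))
      also have "\<dots> = (\<Sum>i\<le>n. ?f i) + ?f 0 + ((\<Sum>i\<le>n. ?f (Suc i)) + ?f (Suc n))"
      proof -
        have "(\<Sum>i\<le>n. f i * (1 + of_bool (i = k))) = (\<Sum>i\<le>n. f i) + f k"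
          if "k \<le> n" for f :: "nat \<Rightarrow> nat" and k
        proof -
          have "(\<Sum>i\<le>n. f i * (1 + of_bool (i = k))) = (\<Sum>i\<le>n. f i + (if i = k then f i else 0))"
            by (intro sum.cong) auto
          then show ?thesis using that by (simp add: sum.distrib)
        qed
        from this[of 0 ?f] this[of n "\<lambda>i. ?f (Suc i)"] show ?thesis
          by (simp only: sum.distrib le0 le_refl)
      qed
      \<comment> \<open>\<open>?f 0\<close> completes the shifted sum and \<open>?f (Suc n)\<close>
        the unshifted one, so every position is counted twice.\<close>
      also have "\<dots> = 2 * (\<Sum>i\<le>Suc n. ?f i)"
        using sum.atMost_Suc[of ?f n] sum.atMost_Suc_shift[of ?f n] by linarith
      also have "(\<Sum>i\<le>Suc n. ?f i) = (\<Sum>x\<in>W. of_bool (x = w))"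
        using sum.reindex[OF walk(3), of "\<lambda>x. of_bool (x = w) :: nat"] by (simp only: W_def o_def)
      also have "\<dots> = of_bool (w \<in> W)"
        by (simp add: W_def of_bool_def)
      finally show ?thesis .
    qed
    have countE: "(\<Sum>s\<in>P. of_bool ({src s, src (r s)} = e)) = 2 * (of_bool (e \<in> induced_edges E W) :: nat)" for e
    proof -
      have "(\<Sum>s\<in>P. of_bool ({src s, src (r s)} = e)) =
          (2 * (\<Sum>i\<le>n. of_bool ({src (d i), src (r (d i))} = e)) :: nat)"
        unfolding sumP sum_distrib_left using r walk(1) by (intro sum.cong) (auto simp: insert_commute)
      also have "(\<Sum>i\<le>n. of_bool ({src (d i), src (r (d i))} = e)) =
          (\<Sum>x\<in>induced_edges E W. of_bool (x = e) :: nat)"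
      proof -
        have "inj_on (\<lambda>i. {src (d i), src (r (d i))}) {..n}"
          by (rule inj_onI) (auto simp: doubleton_eq_iff inj simp flip: walk(2))
        from sum.reindex[OF this, of "\<lambda>x. of_bool (x = e) :: nat"] show ?thesis
          unfolding W_def walk(4) by (simp only: o_def)
      qed
      also have "\<dots> = of_bool (e \<in> induced_edges E W)"
        unfolding W_def walk(4) by (simp add: of_bool_def)
      finally show ?thesis .
    qed
    let ?D = "D - P"
    have "card ?D < card D"
      using fin PD by (intro psubset_card_mono) (auto simp: P_def)
    moreover have "\<forall>s\<in>?D. r s \<in> ?D \<and> r (r s) = s \<and> {src s, src (r s)} \<in> E"
      using r rP by (metis DiffD1 DiffD2 DiffI)
    moreover have "\<forall>s\<in>?D. m s \<in> ?D \<and> m (m s) = s \<and> src (m s) = src s"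
      using m mP by (metis DiffD1 DiffD2 DiffI)
    moreover have "finite ?D"
      using fin by simp
    moreover have "\<forall>s\<in>?D. m s \<noteq> s \<longrightarrow> src (r s) \<noteq> src (r (m s)) \<and> {src (r s), src (r (m s))} \<notin> E"
      using turn by blast
    ultimately have "\<exists>M. (\<forall>W\<in>#M. induced_path V E W) \<and>
      (\<forall>w. 2 * (\<Sum>W\<in>#M. of_bool (w \<in> W)) =
        (\<Sum>t\<in>?D. of_bool (src t = w) * (1 + of_bool (m t = t)) :: nat)) \<and>
      (\<forall>e. 2 * (\<Sum>W\<in>#M. of_bool (e \<in> induced_edges E W)) =
        (\<Sum>t\<in>?D. of_bool ({src t, src (r t)} = e) :: nat))"
      by (intro less.hyps)
    then obtain M where M: "\<forall>W\<in>#M. induced_path V E W"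
      "\<And>w. 2 * (\<Sum>W\<in>#M. of_bool (w \<in> W)) = (\<Sum>t\<in>?D. of_bool (src t = w) * (1 + of_bool (m t = t)) :: nat)"
      "\<And>e. 2 * (\<Sum>W\<in>#M. of_bool (e \<in> induced_edges E W)) =
        (\<Sum>t\<in>?D. of_bool ({src t, src (r t)} = e) :: nat)"
      by blast
    have split: "(\<Sum>t\<in>D. g t) = (\<Sum>t\<in>P. g t) + (\<Sum>t\<in>?D. g t)" for g :: "'b \<Rightarrow> nat"
      using sum.subset_diff[OF PD fin, of g] by simp
    have "induced_path V E W" unfolding W_def by (rule walk(5))
    then show ?thesis
      unfolding split countW countE M(2,3)[symmetric] using M(1)
      by (intro exI[of _ "add_mset W M"]) simp
  qed
qed

section \<open>The local matchings\<close>

lemma simple_graph_edge: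
  assumes "simple_graph V E" "{u, v} \<in> E"
  shows "u \<in> V" "v \<in> V" "u \<noteq> v"
  using assms unfolding simple_graph_def by (auto simp: card_2_iff doubleton_eq_iff)

text \<open>The nonedges \<open>ab\<close> and \<open>cd\<close> are the diagonals of the 4-cycle
  \<open>a, c, b, d\<close>. In the complement this forbids an induced \<open>2K\<^sub>2\<close>,
  which is the property that the matching argument needs of the turns at a vertex.\<close>

lemma chordal_no_C4:
  assumes graph: "simple_graph V E" "chordal V E"
    and edges: "{a, c} \<in> E" "{c, b} \<in> E" "{b, d} \<in> E" "{d, a} \<in> E"
    and nonedges: "{a, b} \<notin> E" "{c, d} \<notin> E" "a \<noteq> b" "c \<noteq> d"
  shows False
proof -
  have E: "e \<subseteq> V \<and> card e = 2" if "e \<in> E" for e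
    using that graph by (auto simp: simple_graph_def)
  have ne: "a \<noteq> c" "c \<noteq> b" "b \<noteq> d" "d \<noteq> a"
    using edges simple_graph_edge(3)[OF graph(1)] by blast+
  let ?vs = "[a, c, b, d]"
  have image: "{f i |i. i < n} = f ` {..<n}" for f :: "nat \<Rightarrow> 'a set" and n
    by blast
  have len: "length ?vs = 4"
    by simp
  have "{..<4::nat} = {0, 1, 2, 3}"
    by (simp add: lessThan_Suc numeral_eq_Suc insert_commute)
  then have "{{?vs ! i, ?vs ! (Suc i mod length ?vs)} |i. i < length ?vs} =
      (\<lambda>i. {?vs ! i, ?vs ! (Suc i mod 4)}) ` {0, 1, 2, 3}"
    unfolding image len by (rule arg_cong)
  also have "\<dots> = {{a, c}, {c, b}, {b, d}, {d, a}}"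
    by simp
  also have "\<dots> = induced_edges E (set ?vs)"
  proof (intro equalityI subsetI)
    fix e assume "e \<in> induced_edges E (set ?vs)"
    then have e: "e \<in> E" "e \<subseteq> {a, c, b, d}"
      by (auto simp: induced_edges_def)
    then obtain x y where "e = {x, y}" "x \<noteq> y"
      using E[OF e(1)] by (auto simp: card_2_iff)
    moreover from this have "x \<in> {a, c, b, d}" "y \<in> {a, c, b, d}"
      using e by auto
    ultimately show "e \<in> {{a, c}, {c, b}, {b, d}, {d, a}}"
      using nonedges e(1) by (auto simp: insert_commute)
  qed (use edges in \<open>auto simp: induced_edges_def\<close>)
  finally have "induced_cycle V E ?vs"
    using ne nonedges edges E unfolding induced_cycle_def by auto
  then show False
    using graph by (auto simp: chordal_def)
qed

text \<open>The token \<open>(u, i)\<close> at \<open>w\<close> is the \<open>i\<close>-th copy of the edge \<open>wu\<close>.\<close>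

definition tokens :: "'a set set \<Rightarrow> ('a set \<Rightarrow> nat) \<Rightarrow> 'a \<Rightarrow> ('a \<times> nat) set" where
  "tokens E N w = {(u, i). {w, u} \<in> E \<and> i < N {w, u}}"

text \<open>Copy numbers are ignored, so two copies of one edge are never paired: a path through
  \<open>w\<close> must not double back, and a chord would spoil inducedness.\<close>

definition turns :: "'a set set \<Rightarrow> 'a \<times> nat \<Rightarrow> 'a \<times> nat \<Rightarrow> bool" where
  "turns E s t \<longleftrightarrow> fst s \<noteq> fst t \<and> {fst s, fst t} \<notin> E"

lemma finite_tokens:
  assumes "simple_graph V E"
  shows "finite (tokens E N w)"
proof -
  have "tokens E N w \<subseteq> (SIGMA u:V. {..<N {w, u}})"
    using simple_graph_edge[OF assms] by (auto simp: tokens_def)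
  moreover have "finite V"
    using assms by (simp add: simple_graph_def)
  ultimately show ?thesis
    by (meson finite_SigmaI finite_lessThan finite_subset)
qed

lemma sum_edges_to: "sum y (edges_to E w A) = (\<Sum>u | u \<in> A \<and> {w, u} \<in> E. y {w, u})"
proof -
  have "edges_to E w A = (\<lambda>u. {w, u}) ` {u. u \<in> A \<and> {w, u} \<in> E}"
    by (auto simp: edges_to_def)
  moreover have "inj_on (\<lambda>u. {w, u}) B" for B
    by (auto simp: inj_on_def doubleton_eq_iff)
  ultimately show ?thesis
    by (simp add: sum.reindex)
qed

lemma card_tokens:
  assumes "simple_graph V E"
  shows "card {t \<in> tokens E N w. fst t \<in> A} = sum N (edges_to E w A)"
proof -
  have "{t \<in> tokens E N w. fst t \<in> A} = (SIGMA u:{u. u \<in> A \<and> {w, u} \<in> E}. {..<N {w, u}})"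
    by (auto simp: tokens_def)
  moreover have "{u. u \<in> A \<and> {w, u} \<in> E} \<subseteq> V"
    using simple_graph_edge[OF assms] by auto
  then have "finite {u. u \<in> A \<and> {w, u} \<in> E}"
    using assms by (auto simp: simple_graph_def intro: finite_subset)
  ultimately show ?thesis
    by (simp add: sum_edges_to)
qed

text \<open>Half of the left-hand side is the number of matched pairs plus unmatched tokens, that
  is, of paths meeting \<open>w\<close>. The obstruction to a better matching projects to a clique
  of neighbors, whose inequality bounds the left-hand side by \<open>2 * X + 1\<close>; evenness
  removes the 1.\<close>

lemma local_matching:
  assumes graph: "simple_graph V E" "chordal V E"
    and bound: "\<And>K. clique V E K \<Longrightarrow> K \<subseteq> neighbors E w \<Longrightarrow>
      sum N (edges_to E w (common_neighbors V E (K \<union> {w}))) + 2 * sum N (edges_to E w K) \<le> 2 * X"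
  shows "\<exists>m. is_matching (tokens E N w) (turns E) m \<and>
    card (tokens E N w) + card (fixed (tokens E N w) m) \<le> 2 * X"
proof -
  let ?T = "tokens E N w"
  have fin: "finite ?T" by (rule finite_tokens[OF graph(1)])
  have free: "a = c \<or> a = d \<or> b = c \<or> b = d \<or> turns E a c \<or> turns E a d \<or> turns E b c \<or> turns E b d"
    if "turns E a b" "turns E c d" for a b c d
  proof (rule ccontr)
    assume contra: "\<not> ?thesis"
    \<comment> \<open>With a common neighbor, one of the two given turns would also be a turn across
      the pairs.\<close>
    have "fst a \<noteq> fst c" "fst a \<noteq> fst d" "fst b \<noteq> fst c" "fst b \<noteq> fst d"
      using that contra by (auto simp: turns_def insert_commute)
    then show False
      using chordal_no_C4[OF graph, of "fst a" "fst c" "fst b" "fst d"] that contra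
      by (auto simp: turns_def insert_commute)
  qed
  have "\<exists>m K. is_matching ?T (turns E) m \<and> K \<subseteq> ?T \<and> (\<forall>a\<in>K. \<forall>b\<in>K. \<not> turns E a b) \<and>
      card ?T + card (fixed ?T m) \<le> 2 * card K + card {c \<in> ?T - K. \<forall>a\<in>K. \<not> turns E a c} + 1"
  proof (rule matching_obstruction[OF fin])
    show "turns E b a" if "turns E a b" for a b
      using that by (auto simp: turns_def insert_commute)
    show "\<not> turns E a a" for a
      by (simp add: turns_def)
  qed (rule free)
  then obtain m K0 where m: "is_matching ?T (turns E) m"
    and K0: "K0 \<subseteq> ?T" "\<forall>a\<in>K0. \<forall>b\<in>K0. \<not> turns E a b"
    and le: "card ?T + card (fixed ?T m) \<le> 2 * card K0 + card {c \<in> ?T - K0. \<forall>a\<in>K0. \<not> turns E a c} + 1"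
    by blast
  \<comment> \<open>Tokens without turns among them lead to equal or adjacent neighbors, so
    \<open>K\<close> is a clique.\<close>
  define K where "K = fst ` K0"
  define C where "C = common_neighbors V E (K \<union> {w})"
  let ?C0 = "{c \<in> ?T - K0. \<forall>a\<in>K0. \<not> turns E a c}"
  let ?TK = "{t \<in> ?T. fst t \<in> K}" and ?TC = "{t \<in> ?T. fst t \<in> C}"
  have token: "{w, fst t} \<in> E \<and> fst t \<in> V \<and> fst t \<noteq> w" if "t \<in> ?T" for t
    using that simple_graph_edge[OF graph(1), of w "fst t"] by (auto simp: tokens_def)
  have "clique V E K"
    using K0 token unfolding clique_def K_def turns_def by blast
  moreover have "K \<subseteq> neighbors E w"
    using K0 token by (auto simp: K_def neighbors_def)
  ultimately have "card ?TC + 2 * card ?TK \<le> 2 * X"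
    using bound unfolding card_tokens[OF graph(1)] C_def by blast
  moreover have "K0 \<subseteq> ?TK"
    using K0 by (auto simp: K_def)
  then have "card K0 \<le> card ?TK"
    using fin by (intro card_mono) auto
  \<comment> \<open>A token having no turn with \<open>K0\<close> either is a copy of an edge to
    \<open>K\<close> or leads to a common neighbor of \<open>K \<union> {w}\<close>.\<close>
  moreover have "card K0 + card ?C0 \<le> card ?TK + card ?TC"
  proof -
    have "t \<in> ?TC" if t: "t \<in> ?C0" "fst t \<notin> K" for t
    proof -
      have "{fst a, fst t} \<in> E" if a: "a \<in> K0" for a
      proof -
        have "\<not> turns E a t" "fst a \<noteq> fst t"
          using a t by (auto simp: K_def image_iff)
        then show ?thesis by (simp add: turns_def)
      qed
      then show ?thesis
        using t token unfolding C_def common_neighbors_def K_def by auto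
    qed
    then have "K0 \<union> ?C0 \<subseteq> ?TK \<union> ?TC"
      using \<open>K0 \<subseteq> ?TK\<close> by blast
    then have "card (K0 \<union> ?C0) \<le> card (?TK \<union> ?TC)"
      using fin by (intro card_mono) auto
    moreover have "card (K0 \<union> ?C0) = card K0 + card ?C0"
      using fin K0 by (intro card_Un_disjoint) (auto intro: finite_subset)
    ultimately show ?thesis
      using card_Un_le[of ?TK ?TC] by linarith
  qed
  ultimately have "card ?T + card (fixed ?T m) \<le> Suc (2 * X)"
    using le by linarith
  moreover have "even (card ?T + card (fixed ?T m))"
    by (rule matching_even[OF fin m])
  ultimately have "card ?T + card (fixed ?T m) \<le> 2 * X"
    by (metis even_Suc even_mult_iff even_numeral le_Suc_eq)
  then show ?thesis using m by blast
qed

section \<open>Induced paths in the cone\<close>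

text \<open>Adjacent vertices of the path have successive indices. An index has at most two such
  neighbors, and three indices cannot be pairwise successive.\<close>

lemma
  assumes graph: "simple_graph V E" and path: "induced_path V E W"
  shows induced_path_degree: "w \<in> W \<Longrightarrow> card {u \<in> W. {w, u} \<in> E} \<le> 2"
    and induced_path_triangle: "a \<in> W \<Longrightarrow> b \<in> W \<Longrightarrow> c \<in> W \<Longrightarrow>
      {a, b} \<in> E \<Longrightarrow> {b, c} \<in> E \<Longrightarrow> {a, c} \<in> E \<Longrightarrow> False"
proof -
  obtain vs where vs: "distinct vs" "set vs = W"
    and edges: "induced_edges E W = {{vs ! i, vs ! Suc i} |i. Suc i < length vs}"
    using path by (auto simp: induced_path_def)
  have index: "\<exists>i<length vs. u = vs ! i" if "u \<in> W" for u
    using that vs(2) by (metis in_set_conv_nth)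
  have adj: "j = Suc i \<or> i = Suc j" if ij: "i < length vs" "j < length vs" "{vs ! i, vs ! j} \<in> E" for i j
  proof -
    have "{vs ! i, vs ! j} \<in> induced_edges E W"
      using ij vs(2) by (auto simp: induced_edges_def)
    then obtain k where "Suc k < length vs" "{vs ! i, vs ! j} = {vs ! k, vs ! Suc k}"
      unfolding edges by blast
    then show ?thesis
      using ij vs(1) by (auto simp: doubleton_eq_iff nth_eq_iff_index_eq)
  qed
  show "card {u \<in> W. {w, u} \<in> E} \<le> 2" if w: "w \<in> W"
  proof -
    obtain i where i: "i < length vs" "w = vs ! i"
      using index[OF w] by blast
    \<comment> \<open>At either end of the list one of these entries is no genuine neighbor, which
      is harmless for an upper bound.\<close>
    have "{u \<in> W. {w, u} \<in> E} \<subseteq> {vs ! (i - 1), vs ! Suc i}"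
    proof
      fix u assume u: "u \<in> {u \<in> W. {w, u} \<in> E}"
      then obtain j where j: "j < length vs" "u = vs ! j"
        using index[of u] by blast
      then have "j = Suc i \<or> i = Suc j"
        using adj[of i j] i u by blast
      then show "u \<in> {vs ! (i - 1), vs ! Suc i}"
        using j by auto
    qed
    then have "card {u \<in> W. {w, u} \<in> E} \<le> card {vs ! (i - 1), vs ! Suc i}"
      by (intro card_mono) auto
    also have "\<dots> \<le> 2"
      by (simp add: card_insert_if)
    finally show ?thesis .
  qed
  show False if abc: "a \<in> W" "b \<in> W" "c \<in> W" "{a, b} \<in> E" "{b, c} \<in> E" "{a, c} \<in> E"
  proof -
    obtain i j k where "i < length vs" "a = vs ! i" "j < length vs" "b = vs ! j" "k < length vs" "c = vs ! k"
      using index abc(1-3) by meson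
    then show False
      using adj[of i j] adj[of j k] adj[of i k] abc(4-6) by auto
  qed
qed

text \<open>Let \<open>w\<close> lie on the path. If the path has a neighbor of \<open>w\<close> in
  \<open>K\<close>, the absence of triangles makes it the only one and excludes neighbors in the
  common neighborhood, so the left-hand side is 2. Otherwise the degree bound gives at most
  2.\<close>

lemma ext_incidence_in_path_cone:
  assumes graph: "simple_graph V E" and path: "induced_path V E W"
  shows "ext_incidence E W \<in> path_cone V E"
proof -
  let ?y = "indicator (induced_edges E W) :: 'a set \<Rightarrow> real"
  have WV: "W \<subseteq> V" using path by (simp add: induced_path_def)
  then have finW: "finite W"
    using graph by (auto simp: simple_graph_def intro: finite_subset)
  have ineq: "sum ?y (edges_to E w (common_neighbors V E (K \<union> {w}))) + 2 * sum ?y (edges_to E w K)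
      \<le> 2 * indicator W w" if w: "w \<in> V" and K: "clique V E K" "K \<subseteq> neighbors E w" for w K
  proof (cases "w \<in> W")
    case False
    have "sum ?y (edges_to E w A) = 0" for A
      using False by (intro sum.neutral) (auto simp: edges_to_def induced_edges_def)
    then show ?thesis by simp
  next
    case True
    have finV: "finite V" using graph by (simp add: simple_graph_def)
    have sum: "sum ?y (edges_to E w A) = card {u \<in> A. u \<in> W \<and> {w, u} \<in> E}" if "A \<subseteq> V" for A
    proof -
      have "finite A" using that finV by (rule finite_subset)
      have "sum ?y (edges_to E w A) = (\<Sum>u | u \<in> A \<and> {w, u} \<in> E. of_bool (u \<in> W))"
        unfolding sum_edges_to using True
        by (intro sum.cong) (auto simp: induced_edges_def indicator_def)
      also have "\<dots> = card ({u. u \<in> A \<and> {w, u} \<in> E} \<inter> {u. u \<in> W})"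
        using \<open>finite A\<close> by simp
      also have "{u. u \<in> A \<and> {w, u} \<in> E} \<inter> {u. u \<in> W} = {u \<in> A. u \<in> W \<and> {w, u} \<in> E}"
        by auto
      finally show ?thesis .
    qed
    let ?C = "common_neighbors V E (K \<union> {w})"
    let ?NK = "{u \<in> K. u \<in> W \<and> {w, u} \<in> E}" and ?NC = "{u \<in> ?C. u \<in> W \<and> {w, u} \<in> E}"
    have "card ?NC + 2 * card ?NK \<le> 2"
    proof (cases "?NK = {}")
      case True
      have "card ?NC \<le> card {u \<in> W. {w, u} \<in> E}"
        using finW by (intro card_mono) auto
      also have "\<dots> \<le> 2"
        by (rule induced_path_degree[OF graph path \<open>w \<in> W\<close>])
      finally show ?thesis
        unfolding True by simp
    next
      case False
      then obtain a where a: "a \<in> K" "a \<in> W" "{w, a} \<in> E" by auto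
      have tri: False if "b \<in> W" "{w, b} \<in> E" "{a, b} \<in> E" for b
        using induced_path_triangle[OF graph path, of w a b] \<open>w \<in> W\<close> a that by blast
      have "{a, u} \<in> E" if "u \<in> ?C" for u
        using that a(1) by (simp add: common_neighbors_def)
      then have NC: "?NC = {}"
        using tri by blast
      have "{a, u} \<in> E" if "u \<in> K" "u \<noteq> a" for u
        using K(1) a(1) that by (simp add: clique_def)
      then have NK: "?NK = {a}"
        using tri a by blast
      show ?thesis unfolding NC NK by simp
    qed
    moreover have "?C \<subseteq> V" "K \<subseteq> V"
      using K by (auto simp: common_neighbors_def clique_def)
    ultimately show ?thesis
      using True by (simp add: sum)
  qed
  then show ?thesis
    using WV by (auto simp: path_cone_def point_space_def ext_incidence_def induced_edges_def indicator_def)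
qed

section \<open>Decomposition of integer points\<close>

lemma sum_mset_eq_sum_count:
  fixes f :: "'b \<Rightarrow> real"
  assumes "finite S" "set_mset A \<subseteq> S"
  shows "(\<Sum>h\<in>S. real (count A h) * f h) = (\<Sum>h\<in>#A. f h)"
  using assms(2)
proof (induction A)
  case (add a A)
  have "(\<Sum>h\<in>S. real (count (add_mset a A) h) * f h) =
      (\<Sum>h\<in>S. real (count A h) * f h + (if h = a then f h else 0))"
    by (intro sum.cong) (auto simp: distrib_right)
  then show ?case
    using add assms(1) by (simp add: sum.distrib)
qed simp

text \<open>The coefficient of a vector is its multiplicity in the image of
  \<open>M\<close>.\<close>

lemma path_multiset_combination:
  assumes paths: "\<forall>W\<in>#M. induced_path V E W"
    and x: "\<And>v. x v = real (\<Sum>W\<in>#M. of_bool (v \<in> W))"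
    and y: "\<And>e. y e = real (\<Sum>W\<in>#M. of_bool (e \<in> induced_edges E W))"
  shows "\<exists>S (c :: 'a point \<Rightarrow> nat). finite S \<and> S \<subseteq> {ext_incidence E W |W. W \<subseteq> V \<and> induced_path V E W} \<and>
    (x, y) = ((\<lambda>v. \<Sum>h\<in>S. real (c h) * fst h v), (\<lambda>e. \<Sum>h\<in>S. real (c h) * snd h e))"
proof (intro exI conjI)
  let ?A = "image_mset (ext_incidence E) M"
  show "finite (set_mset ?A)" by simp
  show "set_mset ?A \<subseteq> {ext_incidence E W |W. W \<subseteq> V \<and> induced_path V E W}"
  proof
    fix h assume "h \<in># ?A"
    then obtain W where "W \<in># M" "h = ext_incidence E W"
      by auto
    moreover from this have "induced_path V E W" "W \<subseteq> V"
      using paths by (simp_all add: induced_path_def)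
    ultimately show "h \<in> {ext_incidence E W |W. W \<subseteq> V \<and> induced_path V E W}"
      by blast
  qed
  have "real (\<Sum>W\<in>#B. of_bool (P W)) = (\<Sum>W\<in>#B. of_bool (P W))" for B :: "'a set multiset" and P
    by (induction B) auto
  then show "(x, y) = ((\<lambda>v. \<Sum>h\<in>set_mset ?A. real (count ?A h) * fst h v),
      (\<lambda>e. \<Sum>h\<in>set_mset ?A. real (count ?A h) * snd h e))"
    by (simp only: sum_mset_eq_sum_count finite_set_mset order_refl)
      (auto simp: x y ext_incidence_def indicator_def image_mset.compositionality o_def)
qed

text \<open>A dart \<open>(w, u, i)\<close> is the token \<open>(u, i)\<close> at \<open>w\<close>,
  and the local matchings together form \<open>m\<close>. The resulting paths have the exact edge
  multiplicities but possibly too few visits to vertices; one-vertex paths, having no edges, supply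
  the rest.\<close>

lemma integer_point_decomposition:
  fixes E :: "'a set set" and X :: "'a \<Rightarrow> nat" and N :: "'a set \<Rightarrow> nat"
  assumes graph: "simple_graph V E" "chordal V E"
    and X: "\<And>v. v \<notin> V \<Longrightarrow> X v = 0" and N: "\<And>e. e \<notin> E \<Longrightarrow> N e = 0"
    and bound: "\<And>w K. w \<in> V \<Longrightarrow> clique V E K \<Longrightarrow> K \<subseteq> neighbors E w \<Longrightarrow>
      sum N (edges_to E w (common_neighbors V E (K \<union> {w}))) + 2 * sum N (edges_to E w K) \<le> 2 * X w"
  shows "\<exists>M. (\<forall>W\<in>#M. induced_path V E W) \<and> (\<forall>v. (\<Sum>W\<in>#M. of_bool (v \<in> W)) = X v) \<and>
    (\<forall>e. (\<Sum>W\<in>#M. of_bool (e \<in> induced_edges E W)) = N e)"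
proof -
  have finV: "finite V" using graph by (simp add: simple_graph_def)
  let ?T = "tokens E N"
  have "\<forall>w\<in>V. \<exists>m. is_matching (?T w) (turns E) m \<and> card (?T w) + card (fixed (?T w) m) \<le> 2 * X w"
    using local_matching[OF graph] bound by blast
  then obtain \<mu> where \<mu>: "\<And>w. w \<in> V \<Longrightarrow> is_matching (?T w) (turns E) (\<mu> w)"
    "\<And>w. w \<in> V \<Longrightarrow> card (?T w) + card (fixed (?T w) (\<mu> w)) \<le> 2 * X w"
    by metis
  define D where "D = (SIGMA w:V. ?T w)"
  \<comment> \<open>Reversal keeps the copy number, as both directions refer to the same
    \<open>N {w, u}\<close>.\<close>
  define r :: "'a \<times> 'a \<times> nat \<Rightarrow> 'a \<times> 'a \<times> nat" where "r = (\<lambda>(w, u, i). (u, w, i))"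
  define m :: "'a \<times> 'a \<times> nat \<Rightarrow> 'a \<times> 'a \<times> nat" where "m = (\<lambda>(w, s). (w, \<mu> w s))"
  have finD: "finite D"
    unfolding D_def using finV finite_tokens[OF graph(1)] by (intro finite_SigmaI) auto
  have D: "(w, u, i) \<in> D \<longleftrightarrow> {w, u} \<in> E \<and> i < N {w, u}" for w u i
    using simple_graph_edge[OF graph(1)] by (auto simp: D_def tokens_def)
  have "\<forall>t\<in>D. r t \<in> D \<and> r (r t) = t \<and> {fst t, fst (r t)} \<in> E"
    by (auto simp: r_def D insert_commute)
  moreover have mD: "m t \<in> D \<and> m (m t) = t \<and> fst (m t) = fst t \<and> (m t \<noteq> t \<longrightarrow> turns E (snd t) (snd (m t)))"
    if t: "t \<in> D" for t
  proof -
    obtain w s where "t = (w, s)" "w \<in> V" "s \<in> ?T w"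
      using t unfolding D_def by blast
    then show ?thesis
      using \<mu>(1)[of w] by (auto simp: m_def D_def is_matching_def)
  qed
  then have "\<forall>t\<in>D. m t \<in> D \<and> m (m t) = t \<and> fst (m t) = fst t"
    by blast
  moreover have "\<forall>t\<in>D. m t \<noteq> t \<longrightarrow> fst (r t) \<noteq> fst (r (m t)) \<and> {fst (r t), fst (r (m t))} \<notin> E"
  proof -
    have "fst (r t) = fst (snd t)" for t
      by (auto simp: r_def split: prod.split)
    then show ?thesis using mD by (simp add: turns_def)
  qed
  ultimately have "\<exists>M. (\<forall>W\<in>#M. induced_path V E W) \<and>
      (\<forall>w. 2 * (\<Sum>W\<in>#M. of_bool (w \<in> W)) =
        (\<Sum>t\<in>D. of_bool (fst t = w) * (1 + of_bool (m t = t)) :: nat)) \<and>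
      (\<forall>e. 2 * (\<Sum>W\<in>#M. of_bool (e \<in> induced_edges E W)) =
        (\<Sum>t\<in>D. of_bool ({fst t, fst (r t)} = e) :: nat))"
    by (rule dart_decomposition[OF graph finD])
  then obtain M where M: "\<forall>W\<in>#M. induced_path V E W"
    and Mv: "\<And>w. 2 * (\<Sum>W\<in>#M. of_bool (w \<in> W)) = (\<Sum>t\<in>D. of_bool (fst t = w) * (1 + of_bool (m t = t)) :: nat)"
    and Me: "\<And>e. 2 * (\<Sum>W\<in>#M. of_bool (e \<in> induced_edges E W)) = (\<Sum>t\<in>D. of_bool ({fst t, fst (r t)} = e) :: nat)"
    by blast
  have Mv': "(\<Sum>W\<in>#M. of_bool (w \<in> W)) \<le> X w" if w: "w \<in> V" for w
  proof -
    have "(\<Sum>t\<in>D. of_bool (fst t = w) * (1 + of_bool (m t = t)) :: nat) =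
        (\<Sum>t\<in>{t \<in> D. fst t = w}. 1 + of_bool (m t = t))"
      using finD by (simp only: sum.inter_filter) (auto intro!: sum.cong)
    also have "{t \<in> D. fst t = w} = Pair w ` ?T w"
      using w by (auto simp: D_def)
    also have "(\<Sum>t\<in>Pair w ` ?T w. 1 + of_bool (m t = t) :: nat) = (\<Sum>s\<in>?T w. 1 + of_bool (\<mu> w s = s))"
      by (simp add: sum.reindex inj_on_def m_def)
    also have "\<dots> = card (?T w) + card (fixed (?T w) (\<mu> w))"
      using finite_tokens[OF graph(1), of N w] by (simp add: sum_Suc fixed_def Int_def)
    finally show ?thesis
      using Mv[of w] \<mu>(2)[OF w] by linarith
  qed
  have Me': "(\<Sum>W\<in>#M. of_bool (e \<in> induced_edges E W)) = N e" for e
  proof (cases "e \<in> E")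
    case False
    then show ?thesis using N by (auto simp: induced_edges_def)
  next
    case True
    then obtain a b where e: "e = {a, b}" "a \<noteq> b"
      using graph by (auto simp: simple_graph_def card_2_iff)
    have "(\<Sum>t\<in>D. of_bool ({fst t, fst (r t)} = e) :: nat) = card {t \<in> D. {fst t, fst (r t)} = e}"
      using finD by (simp add: Int_def)
    also have "{t \<in> D. {fst t, fst (r t)} = e} =
        (\<lambda>i. (a, b, i)) ` {..<N e} \<union> (\<lambda>i. (b, a, i)) ` {..<N e}"
      using True e by (auto simp: r_def D doubleton_eq_iff insert_commute)
    also have "card \<dots> = 2 * N e"
      using e by (subst card_Un_disjoint) (auto simp: card_image inj_on_def)
    finally show ?thesis using Me[of e] by simp
  qed
  \<comment> \<open>On \<open>V\<close> this truncated subtraction is exact by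
    \<open>Mv'\<close>.\<close>
  define k where "k w = X w - (\<Sum>W\<in>#M. of_bool (w \<in> W))" for w
  define B where "B = (\<Sum>w\<in>V. replicate_mset (k w) w)"
  have countB: "count B v = (if v \<in> V then k v else 0)" for v
    using finV by (simp add: B_def count_sum)
  let ?M = "M + image_mset (\<lambda>w. {w}) B"
  have single: "induced_edges E {w} = {}" for w
    using graph by (auto simp: induced_edges_def simple_graph_def subset_singleton_iff)
  have "induced_path V E {w}" if "w \<in># B" for w
  proof -
    have "w \<in> V"
      using that countB[of w] by (metis count_eq_zero_iff)
    then show ?thesis
      using single[of w] unfolding induced_path_def by (intro conjI exI[of _ "[w]"]) auto
  qed
  then have "\<forall>W\<in>#?M. induced_path V E W"
    using M by auto
  moreover have "(\<Sum>W\<in>#?M. of_bool (v \<in> W)) = X v" for v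
  proof (cases "v \<in> V")
    case True
    have "(\<Sum>W\<in>#?M. of_bool (v \<in> W)) = (\<Sum>W\<in>#M. of_bool (v \<in> W)) + count B v"
      by (simp add: image_mset.compositionality o_def of_bool_def sum_mset_delta')
    then show ?thesis using Mv'[OF True] True by (simp add: countB k_def)
  next
    case False
    then have "v \<notin> W" if "W \<in># ?M" for W
      using that calculation by (auto simp: induced_path_def)
    then show ?thesis using X False by simp
  qed
  moreover have "(\<Sum>W\<in>#?M. of_bool (e \<in> induced_edges E W)) = N e" for e
    using Me'[of e] by (simp add: single image_mset.compositionality o_def)
  ultimately show ?thesis by blast
qed

theorem theorem2p5:
  fixes V :: "'a set" and E :: "'a set set"
  assumes "simple_graph V E" and "chordal V E"
  shows "hilbert_basis {ext_incidence E W |W. W \<subseteq> V \<and> induced_path V E W} (path_cone V E)"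
  unfolding hilbert_basis_def
proof (intro conjI ballI impI)
  show "{ext_incidence E W |W. W \<subseteq> V \<and> induced_path V E W} \<subseteq> path_cone V E"
    using ext_incidence_in_path_cone[OF assms(1)] by blast
  fix z :: "'a point" assume z: "z \<in> path_cone V E" "integer_point z"
  obtain x y where xy: "z = (x, y)" by fastforce
  \<comment> \<open>Rounding loses nothing: all coordinates are integers, nonnegative on
    \<open>V\<close> and \<open>E\<close> and zero elsewhere.\<close>
  define X where "X v = nat \<lfloor>x v\<rfloor>" for v
  define N where "N e = nat \<lfloor>y e\<rfloor>" for e
  have nonneg: "x v \<ge> 0" "y e \<ge> 0" for v e
    using z unfolding xy path_cone_def point_space_def by (cases "v \<in> V"; cases "e \<in> E"; auto)+
  have X: "x v = real (X v)" and N: "y e = real (N e)" for v e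
    using z nonneg unfolding xy integer_point_def X_def N_def by (auto elim!: Ints_cases)
  have "sum N (edges_to E w (common_neighbors V E (K \<union> {w}))) + 2 * sum N (edges_to E w K) \<le> 2 * X w"
    if "w \<in> V" "clique V E K" "K \<subseteq> neighbors E w" for w K
  proof -
    have "sum y (edges_to E w (common_neighbors V E (K \<union> {w}))) + 2 * sum y (edges_to E w K) \<le> 2 * x w"
      using z that unfolding xy path_cone_def by blast
    then have "real (sum N (edges_to E w (common_neighbors V E (K \<union> {w}))) + 2 * sum N (edges_to E w K))
        \<le> real (2 * X w)"
      by (simp add: X N)
    then show ?thesis by (rule of_nat_le_iff[THEN iffD1])
  qed
  moreover have "X v = 0" if "v \<notin> V" for v
    using z that unfolding xy path_cone_def point_space_def X_def by simp
  moreover have "N e = 0" if "e \<notin> E" for e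
    using z that unfolding xy path_cone_def point_space_def N_def by simp
  ultimately have "\<exists>M. (\<forall>W\<in>#M. induced_path V E W) \<and> (\<forall>v. (\<Sum>W\<in>#M. of_bool (v \<in> W)) = X v) \<and>
      (\<forall>e. (\<Sum>W\<in>#M. of_bool (e \<in> induced_edges E W)) = N e)"
    by (intro integer_point_decomposition[OF assms])
  then obtain M where M: "\<forall>W\<in>#M. induced_path V E W"
    and Mv: "\<forall>v. (\<Sum>W\<in>#M. of_bool (v \<in> W)) = X v"
    and Me: "\<forall>e. (\<Sum>W\<in>#M. of_bool (e \<in> induced_edges E W)) = N e"
    by blast
  show "\<exists>S c. finite S \<and> S \<subseteq> {ext_incidence E W |W. W \<subseteq> V \<and> induced_path V E W} \<and>
      z = ((\<lambda>v. \<Sum>h\<in>S. real (c h) * fst h v), (\<lambda>e. \<Sum>h\<in>S. real (c h) * snd h e))"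
    unfolding xy
  proof (rule path_multiset_combination[OF M])
    show "x v = real (\<Sum>W\<in>#M. of_bool (v \<in> W))" for v
      using X Mv by simp
    show "y e = real (\<Sum>W\<in>#M. of_bool (e \<in> induced_edges E W))" for e
      using N Me by simp
  qed
qed

end
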